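(* Let $G=(V,q)$ be a reversible connected graph with non-negative Ollivier curvature. Then for all $f\in\ell_\infty(V)$ and $t>0$, \[ \|\nabla P_tf\|_\infty\le\frac{\|f\|_\infty}{\sqrt{t\,q_{\min}}}. \]
   Context: A graph $G=(V,q)$ consists of a countable set $V$ and a function $q:V\times V\to[0,\infty)$ such that $\#\{y:q(x,y)>0\}<\infty$ for every $x\in V$; its Laplacian is $\Delta f(x)=\sum_y q(x,y)(f(y)-f(x))$. $G$ is reversible if there is $m:V\to(0,\infty)$ with $q(x,y)m(x)=q(y,x)m(y)$. For reversible $G$, $d$ is the combinatorial graph distance (finite since $G$ is connected). $q_{\min}:=\inf\{q(x,y):q(x,y)>0\}$. $\ell_\infty(V)$ is the space of bounded functions with sup norm. Ollivier curvature: for $x\ne y$ let $\nabla_{xy}f=(f(x)-f(y))/d(x,y)$, $\|\nabla f\|_\infty=\sup_{x\ne y}|\nabla_{xy}f|$, $\kappa(x,y)=\inf\{\nabla_{xy}\Delta f:\|\nabla f\|_\infty=1,\ \nabla_{yx}f=1\}$; non-negative Ollivier curvature means $\kappa(x,y)\ge0$ for all $x\ne y$. Heat semigroup: for finite $S$ let $q_S(x,y)=q(x,y)1_S(x)$ with Laplacian $\Delta_S$ and $P^S_tf=\sum_{k\ge0}t^k\Delta_S^k(f1_S)/k!$; for $f\in\ell_\infty(V)$, $P_tf=\lim_iP_t^{S_i}f$ pointwise along any increasing exhaustion of $V$ by finite sets. *)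

theory Defs
  imports "HOL-Analysis.Analysis"
begin

definition graph :: "('v \<Rightarrow> 'v \<Rightarrow> real) \<Rightarrow> bool" where
  "graph q \<longleftrightarrow> (\<forall>x y. q x y \<ge> 0) \<and> (\<forall>x. finite {y. q x y > 0})"

definition laplacian :: "('v \<Rightarrow> 'v \<Rightarrow> real) \<Rightarrow> ('v \<Rightarrow> real) \<Rightarrow> 'v \<Rightarrow> real" where
  "laplacian q f x = (\<Sum>y\<in>{y. q x y > 0}. q x y * (f y - f x))"

definition reversible :: "('v \<Rightarrow> 'v \<Rightarrow> real) \<Rightarrow> bool" where
  "reversible q \<longleftrightarrow> (\<exists>m::'v \<Rightarrow> real. (\<forall>x. m x > 0) \<and> (\<forall>x y. q x y * m x = q y x * m y))"

definition edges :: "('v \<Rightarrow> 'v \<Rightarrow> real) \<Rightarrow> ('v \<times> 'v) set" where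
  "edges q = {(x, y). q x y > 0}"

definition connected_graph :: "('v \<Rightarrow> 'v \<Rightarrow> real) \<Rightarrow> bool" where
  "connected_graph q \<longleftrightarrow> (\<forall>x y. \<exists>n. (x, y) \<in> edges q ^^ n)"

definition dist_graph :: "('v \<Rightarrow> 'v \<Rightarrow> real) \<Rightarrow> 'v \<Rightarrow> 'v \<Rightarrow> nat" where
  "dist_graph q x y = (LEAST n. (x, y) \<in> edges q ^^ n)"

definition grad :: "('v \<Rightarrow> 'v \<Rightarrow> real) \<Rightarrow> 'v \<Rightarrow> 'v \<Rightarrow> ('v \<Rightarrow> real) \<Rightarrow> real" where
  "grad q x y f = (f x - f y) / real (dist_graph q x y)"

definition grad_norm :: "('v \<Rightarrow> 'v \<Rightarrow> real) \<Rightarrow> ('v \<Rightarrow> real) \<Rightarrow> ereal" where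
  "grad_norm q f = (SUP p \<in> {(x, y). x \<noteq> y}. ereal \<bar>grad q (fst p) (snd p) f\<bar>)"

definition ollivier :: "('v \<Rightarrow> 'v \<Rightarrow> real) \<Rightarrow> 'v \<Rightarrow> 'v \<Rightarrow> ereal" where
  "ollivier q x y = (INF f \<in> {f. grad_norm q f = 1 \<and> grad q y x f = 1}.
                        ereal (grad q x y (laplacian q f)))"

definition nonneg_ollivier :: "('v \<Rightarrow> 'v \<Rightarrow> real) \<Rightarrow> bool" where
  "nonneg_ollivier q \<longleftrightarrow> (\<forall>x y. x \<noteq> y \<longrightarrow> ollivier q x y \<ge> 0)"

definition q_min :: "('v \<Rightarrow> 'v \<Rightarrow> real) \<Rightarrow> real" where
  "q_min q = Inf {q x y | x y. q x y > 0}"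

definition bounded_fun :: "('v \<Rightarrow> real) \<Rightarrow> bool" where
  "bounded_fun f \<longleftrightarrow> (\<exists>C. \<forall>x. \<bar>f x\<bar> \<le> C)"

definition sup_norm :: "('v \<Rightarrow> real) \<Rightarrow> real" where
  "sup_norm f = (SUP x. \<bar>f x\<bar>)"

definition laplacian_restr :: "('v \<Rightarrow> 'v \<Rightarrow> real) \<Rightarrow> 'v set \<Rightarrow> ('v \<Rightarrow> real) \<Rightarrow> 'v \<Rightarrow> real" where
  "laplacian_restr q S f = laplacian (\<lambda>x y. q x y * indicator S x) f"

definition heat_restr :: "('v \<Rightarrow> 'v \<Rightarrow> real) \<Rightarrow> 'v set \<Rightarrow> real \<Rightarrow> ('v \<Rightarrow> real) \<Rightarrow> 'v \<Rightarrow> real" where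
  "heat_restr q S t f x =
     (\<Sum>k. t ^ k / fact k * ((laplacian_restr q S ^^ k) (\<lambda>z. f z * indicator S z)) x)"

definition exhaustion :: "(nat \<Rightarrow> 'v set) \<Rightarrow> bool" where
  "exhaustion S \<longleftrightarrow> (\<forall>i. finite (S i)) \<and> incseq S \<and> (\<Union>i. S i) = UNIV"

definition heat :: "('v \<Rightarrow> 'v \<Rightarrow> real) \<Rightarrow> real \<Rightarrow> ('v \<Rightarrow> real) \<Rightarrow> 'v \<Rightarrow> real" where
  "heat q t f x = (THE v. \<forall>S. exhaustion S \<longrightarrow> (\<lambda>i. heat_restr q (S i) t f x) \<longlonglongrightarrow> v)"

end

theory Submission
  imports Defs
begin

text \<open>Doubling of variables: with \<open>u = P\<^sub>t f\<close> and \<open>M\<close> the sup norm of \<open>f\<close>, compare \<open>u x - u y\<close> with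
  \<open>2 M \<phi>(t, d x y)\<close> by the maximum principle. At a maximum, non-negative curvature gives
  \<open>\<Delta> u x - \<Delta> u y \<le> 2 q_min (\<phi>(n + 1) + \<phi>(n - 1) - 2 \<phi>(n))\<close> for \<open>n = d x y\<close> and concave increasing
  \<open>\<phi>\<close>, since both points may jump one step towards each other. The parabola
  \<open>\<phi> = 1 - (1 - n / sqrt A)\<^sup>2\<close>, continued by \<open>1\<close>, with \<open>A\<close> growing like \<open>16 q_min t\<close>, is a supersolution, and
  \<open>\<phi> \<le> 2 n / sqrt A\<close> is exactly the claimed constant. The unboundedness of the graph is
  handled by a penalty \<open>\<epsilon> d(o, x)\<close>, as \<open>\<Delta> d(o, x) \<le> \<Delta> d(o, o)\<close>; this also yields the
  convergence of the Dirichlet semigroups.\<close>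

section \<open>Parabolic maximum principle\<close>

text \<open>A positive maximum over \<open>K\<close> and \<open>[a,b]\<close> is not at time
  \<open>a\<close>, and a negative time derivative there would make slightly earlier values larger.
  The sign of \<open>w'\<close> is required only at positive spatial maxima and no equation is
  imposed, so \<open>K\<close> may consist of points or of pairs of points.\<close>

lemma parabolic_max_principle:
  fixes w w' :: "real \<Rightarrow> 'a \<Rightarrow> real"
  assumes K: "finite K" and ab: "a \<le> b"
    and deriv: "\<And>s p. p \<in> K \<Longrightarrow> a \<le> s \<Longrightarrow> s \<le> b \<Longrightarrow> ((\<lambda>s. w s p) has_real_derivative w' s p) (at s)"
    and init: "\<And>p. p \<in> K \<Longrightarrow> w a p \<le> 0"
    and neg: "\<And>s p. p \<in> K \<Longrightarrow> a < s \<Longrightarrow> s \<le> b \<Longrightarrow> 0 < w s p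
        \<Longrightarrow> (\<And>p'. p' \<in> K \<Longrightarrow> w s p' \<le> w s p) \<Longrightarrow> w' s p < 0"
    and p: "p \<in> K"
  shows "w b p \<le> 0"
proof (rule ccontr)
  assume "\<not> w b p \<le> 0"
  have "\<exists>s\<in>{a..b}. \<forall>r\<in>{a..b}. w r z \<le> w s z" if "z \<in> K" for z
  proof (rule continuous_attains_sup)
    show "continuous_on {a..b} (\<lambda>s. w s z)"
      by (intro continuous_at_imp_continuous_on ballI)
        (use deriv[OF that] in \<open>auto intro: DERIV_isCont\<close>)
  qed (use ab in auto)
  then obtain m where m: "\<And>z. z \<in> K \<Longrightarrow> m z \<in> {a..b}"
      "\<And>z r. z \<in> K \<Longrightarrow> r \<in> {a..b} \<Longrightarrow> w r z \<le> w (m z) z"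
    by metis
  have "\<exists>z\<in>K. \<forall>y\<in>K. w (m y) y \<le> w (m z) z"
  proof -
    have "Max ((\<lambda>y. w (m y) y) ` K) \<in> (\<lambda>y. w (m y) y) ` K"
      using K p by (intro Max_in) auto
    then obtain z where "z \<in> K" "w (m z) z = Max ((\<lambda>y. w (m y) y) ` K)" by auto
    then show ?thesis using K by (intro bexI[of _ z]) auto
  qed
  then obtain z where z: "z \<in> K" "\<And>y. y \<in> K \<Longrightarrow> w (m y) y \<le> w (m z) z" by blast
  define s where "s = m z"
  have s: "a \<le> s" "s \<le> b" using m(1)[OF z(1)] by (auto simp: s_def)
  have glob: "w r y \<le> w s z" if "y \<in> K" "r \<in> {a..b}" for r y
    using m(2)[OF that] z(2)[OF that(1)] by (simp add: s_def)
  have pos: "0 < w s z" using glob[OF p, of b] \<open>\<not> w b p \<le> 0\<close> ab by auto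
  have "s \<noteq> a" using init[OF z(1)] pos by auto
  then have as: "a < s" using s by simp
  have "w' s z < 0" by (rule neg) (use z as s pos glob in auto)
  then obtain e where e: "e > 0" "\<And>h. h > 0 \<Longrightarrow> h < e \<Longrightarrow> w s z < w (s - h) z"
    using DERIV_neg_dec_left[OF deriv[OF z(1) s]] by blast
  define h where "h = min (e / 2) (s - a)"
  have "w s z < w (s - h) z" by (rule e(2)) (use e as in \<open>auto simp: h_def\<close>)
  moreover have "w (s - h) z \<le> w s z"
    by (rule glob) (use z as s e in \<open>auto simp: h_def min_def\<close>)
  ultimately show False by simp
qed

section \<open>Concave moduli and the profile\<close>

text \<open>Decreasing increments make the slope of the cell from \<open>n\<close> to
  \<open>Suc n\<close> a supporting slope at both of its ends. Both forms are later applied at one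
  point, with the slope to its right and the slope to its left.\<close>

lemma concave_seq_tangent:
  fixes \<phi> :: "nat \<Rightarrow> real"
  assumes conc: "\<And>n. \<phi> (Suc (Suc n)) - \<phi> (Suc n) \<le> \<phi> (Suc n) - \<phi> n"
  shows concave_seq_tangent_right: "\<phi> m - \<phi> n \<le> (\<phi> (Suc n) - \<phi> n) * (real m - real n)"
    and concave_seq_tangent_left: "m \<le> n \<Longrightarrow>
      \<phi> m - \<phi> (Suc n) \<le> (\<phi> (Suc n) - \<phi> n) * (real m - real (Suc n))"
proof -
  define D where "D n = \<phi> (Suc n) - \<phi> n" for n
  have anti: "D j \<le> D i" if "i \<le> j" for i j
    using that by (rule lift_Suc_antimono_le[rotated]) (use conc in \<open>simp add: D_def\<close>)
  have up: "\<phi> (n + k) - \<phi> n \<le> D n * real k" for n k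
  proof (induction k)
    case (Suc k)
    have "\<phi> (n + Suc k) - \<phi> (n + k) \<le> D n" using anti[of n "n + k"] by (simp add: D_def)
    with Suc show ?case by (simp add: algebra_simps)
  qed simp
  have down: "\<phi> n - \<phi> (n + k) \<le> - D (n + k) * real k" for n k
  proof (induction k)
    case (Suc k)
    have "D (n + Suc k) \<le> D (n + k)" by (rule anti) simp
    then have "D (n + Suc k) * real k \<le> D (n + k) * real k" by (intro mult_right_mono) auto
    moreover have "\<phi> (n + k) - \<phi> (n + Suc k) \<le> - D (n + Suc k)"
      using anti[of "n + k" "n + Suc k"] by (simp add: D_def)
    ultimately show ?case using Suc by (simp add: algebra_simps)
  qed simp
  show "\<phi> m - \<phi> n \<le> (\<phi> (Suc n) - \<phi> n) * (real m - real n)"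
  proof (cases "n \<le> m")
    case True
    then show ?thesis using up[of n "m - n"] by (simp add: D_def of_nat_diff)
  next
    case False
    then show ?thesis using down[of m "n - m"] by (simp add: D_def of_nat_diff algebra_simps)
  qed
  show "\<phi> m - \<phi> (Suc n) \<le> (\<phi> (Suc n) - \<phi> n) * (real m - real (Suc n))" if "m \<le> n"
    using down[of m "n - m"] that by (simp add: D_def of_nat_diff algebra_simps)
qed

section \<open>The truncated parabola and its evolution\<close>

definition parabola :: "real \<Rightarrow> nat \<Rightarrow> real" where
  "parabola A n = 1 - (max 0 (1 - real n / sqrt A))\<^sup>2"

lemma parabola_0 [simp]: "parabola A 0 = 0"
  by (simp add: parabola_def)

lemma parabola_mono:
  assumes "A > 0" shows "parabola A n \<le> parabola A (Suc n)"
proof -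
  have "real n / sqrt A \<le> real (Suc n) / sqrt A" using assms by (intro divide_right_mono) auto
  then have "(max 0 (1 - real (Suc n) / sqrt A))\<^sup>2 \<le> (max 0 (1 - real n / sqrt A))\<^sup>2"
    by (intro power_mono) auto
  then show ?thesis by (simp add: parabola_def)
qed

lemma parabola_nonneg:
  assumes "A > 0" shows "0 \<le> parabola A n"
  using parabola_mono[OF assms] by (induction n) (auto intro: order_trans)

text \<open>The positive part of an affine function is convex and non-negative, so its square is
  convex, kink included.\<close>

lemma parabola_concave:
  "parabola A (Suc (Suc n)) - parabola A (Suc n) \<le> parabola A (Suc n) - parabola A n"
proof -
  define r where "r n = max 0 (1 - real n / sqrt A)" for n
  have r: "r (Suc n) \<le> (r n + r (Suc (Suc n))) / 2"
    unfolding r_def by (auto simp: max_def add_divide_distrib diff_divide_distrib)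
  have "(r (Suc n))\<^sup>2 \<le> ((r n + r (Suc (Suc n))) / 2)\<^sup>2"
    by (rule power_mono[OF r]) (simp add: r_def)
  also have "\<dots> \<le> ((r n)\<^sup>2 + (r (Suc (Suc n)))\<^sup>2) / 2"
    using zero_le_power2[of "r n - r (Suc (Suc n))"] by (simp add: power2_eq_square field_simps)
  finally show ?thesis by (simp add: parabola_def r_def)
qed

text \<open>This is the initial profile: it allows the full oscillation of arbitrary bounded data
  off the diagonal, and \<open>1\<close> is the largest \<open>A\<close> for which it does.\<close>

lemma parabola_1: "n > 0 \<Longrightarrow> parabola 1 n = 1"
  by (simp add: parabola_def max_def)

lemma parabola_le_linear:
  assumes "A > 0" shows "parabola A n \<le> 2 * real n / sqrt A"
proof -
  have "1 - (max 0 (1 - z))\<^sup>2 \<le> 2 * z" if "z \<ge> 0" for z :: real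
    using that by (auto simp: max_def power2_eq_square algebra_simps)
  from this[of "real n / sqrt A"] show ?thesis using assms by (simp add: parabola_def)
qed

text \<open>The time derivative of \<open>parabola A n\<close> while \<open>A\<close> moves with
  speed \<open>\<beta>\<close>.\<close>

definition parabola_deriv :: "real \<Rightarrow> real \<Rightarrow> nat \<Rightarrow> real" where
  "parabola_deriv \<beta> A n = - (\<beta> * real n * max 0 (1 - real n / sqrt A) / (sqrt A * A))"

text \<open>The square smooths the kink, so the profile stays differentiable in time when
  \<open>sqrt A\<close> passes an integer.\<close>

lemma has_real_derivative_pos_part_square:
  "((\<lambda>x::real. (max 0 x)\<^sup>2) has_real_derivative 2 * max 0 x) (at x)"
proof -
  consider "x > 0" | "x < 0" | "x = 0" by linarith
  then show ?thesis
  proof cases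
    case 1
    have "((\<lambda>x::real. x\<^sup>2) has_real_derivative 2 * max 0 x) (at x)"
      using 1 by (auto intro!: derivative_eq_intros)
    then show ?thesis
      by (rule has_field_derivative_transform_within_open[where S="{0<..}"]) (use 1 in auto)
  next
    case 2
    have "((\<lambda>x::real. 0) has_real_derivative 2 * max 0 x) (at x)"
      using 2 by (auto intro!: derivative_eq_intros)
    then show ?thesis
      by (rule has_field_derivative_transform_within_open[where S="{..<0}"]) (use 2 in auto)
  next
    case 3
    have "((\<lambda>h::real. (max 0 h)\<^sup>2 / h) \<longlongrightarrow> 0) (at 0)"
    proof (rule tendsto_sandwich)
      show "\<forall>\<^sub>F h::real in at 0. - \<bar>h\<bar> \<le> (max 0 h)\<^sup>2 / h"
        by (auto simp: max_def power2_eq_square intro!: always_eventually)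
      show "\<forall>\<^sub>F h::real in at 0. (max 0 h)\<^sup>2 / h \<le> \<bar>h\<bar>"
        by (auto simp: max_def power2_eq_square intro!: always_eventually)
      show "((\<lambda>h::real. - \<bar>h\<bar>) \<longlongrightarrow> 0) (at 0)" by (auto intro!: tendsto_eq_intros)
      show "((\<lambda>h::real. \<bar>h\<bar>) \<longlongrightarrow> 0) (at 0)" by (auto intro!: tendsto_eq_intros)
    qed
    then show ?thesis using 3 by (simp add: DERIV_def)
  qed
qed

lemma parabola_has_derivative:
  assumes A: "\<alpha> + \<beta> * s > 0"
  shows "((\<lambda>s. parabola (\<alpha> + \<beta> * s) n) has_real_derivative parabola_deriv \<beta> (\<alpha> + \<beta> * s) n) (at s)"
proof -
  define A where "A = \<alpha> + \<beta> * s"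
  have A0: "A > 0" "\<alpha> + \<beta> * s = A" using A by (auto simp: A_def)
  have 1: "((\<lambda>s. 1 - real n / sqrt (\<alpha> + \<beta> * s)) has_real_derivative
      real n * \<beta> / (2 * (sqrt A * A))) (at s)"
    by (rule derivative_eq_intros refl | use A0 in \<open>simp; fail\<close>)+
      (use A0 in \<open>simp add: field_simps\<close>)
  have "((\<lambda>s. (max 0 (1 - real n / sqrt (\<alpha> + \<beta> * s)))\<^sup>2) has_real_derivative
      2 * max 0 (1 - real n / sqrt A) * (real n * \<beta> / (2 * (sqrt A * A)))) (at s)"
    using DERIV_chain2[OF has_real_derivative_pos_part_square 1] A0 by simp
  from DERIV_diff[OF DERIV_const[of 1] this] show ?thesis
    unfolding parabola_def parabola_deriv_def A0(2)
    by (rule DERIV_cong) (simp add: mult_ac)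
qed

text \<open>The kink of the parabola lies at \<open>sqrt A\<close>; the speed \<open>8\<close> of \<open>A\<close> is the sharp one away from the
  kink, but slightly too large in the cell \<open>n = 1 < sqrt A < 2\<close>.\<close>

lemma parabola_supersolution:
  assumes n: "n > 0" and A: "1 \<le> A" and speed: "\<beta> = 7 \<and> A \<le> 4 \<or> \<beta> = 8 \<and> 4 \<le> A"
  shows "parabola A (Suc n) + parabola A (n - 1) - 2 * parabola A n \<le> parabola_deriv \<beta> A n"
proof -
  define a where "a = sqrt A"
  have a: "a \<ge> 1" "A = a * a" using A by (auto simp: a_def)
  have spd: "\<beta> = 7 \<and> a \<le> 2 \<or> \<beta> = 8 \<and> 2 \<le> a"
    using speed unfolding a_def by (auto simp: real_le_lsqrt real_le_rsqrt)
  have sq: "sqrt A = a" by (simp add: a_def)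
  have n1: "real (n - 1) = real n - 1" using n by (simp add: of_nat_diff)
  consider "real n \<ge> a" | "real n + 1 \<le> a" | "real n < a" "a < real n + 1" by linarith
  then show ?thesis
  proof cases
    case 1
    \<comment> \<open>Beyond the kink the profile is stationary, and concavity suffices.\<close>
    then have "parabola_deriv \<beta> A n = 0" using a by (simp add: parabola_deriv_def sq max_def field_simps)
    moreover obtain k where "n = Suc k" using n by (cases n) auto
    ultimately show ?thesis using parabola_concave[of A k] by simp
  next
    case 2
    define z where "z = real n / a"
    \<comment> \<open>All three points lie on the quadratic branch. The constraint
      \<open>\<beta> * (z * (1 - z)) \<le> 2\<close>, critical at \<open>z = 1/2\<close>, is the
      origin of the speed \<open>8\<close>.\<close>
    have "parabola A (Suc n) + parabola A (n - 1) - 2 * parabola A n = - 2 / (a * a)"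
      using 2 a n by (simp add: parabola_def sq n1 max_def) (simp add: field_simps power2_eq_square)
    moreover have "parabola_deriv \<beta> A n = - (\<beta> * (z * (1 - z))) / (a * a)"
      using 2 a n by (simp add: parabola_deriv_def sq max_def z_def field_simps)
    moreover have "z * (1 - z) \<le> 1 / 4"
      using zero_le_power2[of "z - 1/2"] by (simp add: power2_eq_square algebra_simps)
    then have "\<beta> * (z * (1 - z)) \<le> 2" using spd by auto
    ultimately show ?thesis using a by (simp add: divide_right_mono)
  next
    case 3
    \<comment> \<open>Now \<open>Suc n\<close> lies past the kink, so the second difference is only
      \<open>- (2 - (1 - e)\<^sup>2) / A\<close> instead of \<open>- 2 / A\<close>.\<close>
    define e where "e = a - real n"
    have e: "0 < e" "e < 1" "a = real n + e" using 3 by (auto simp: e_def)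
    have e2: "e\<^sup>2 \<le> e" using e by (simp add: power2_eq_square mult_left_le)
    have main: "\<beta> * (real n * e) \<le> (1 + 2 * e - e\<^sup>2) * (a * a)"
      using spd
    proof
      assume h: "\<beta> = 7 \<and> a \<le> 2"
      then have "real n < 2" using 3 by linarith
      then have nn: "real n = 1" using n by simp
      \<comment> \<open>With \<open>n = 1\<close> the claim reads
        \<open>7 * e \<le> 1 + 4 * e + 4 * e\<^sup>2 - e ^ 4\<close>. With \<open>8\<close> in place
        of \<open>7\<close> it would fail at \<open>e = 1/2\<close>.\<close>
      have "e ^ 4 \<le> e\<^sup>2" using e by (intro power_decreasing) auto
      moreover have "0 \<le> 1 - 3 * e + 3 * e\<^sup>2"
        using zero_le_power2[of "e - 1/2"] by (simp add: power2_eq_square algebra_simps)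
      moreover have "(1 + 2 * e - e\<^sup>2) * (a * a) = 1 + 4 * e + 4 * e\<^sup>2 - e ^ 4"
        using e nn by (simp add: algebra_simps power2_eq_square power4_eq_xxxx)
      ultimately show ?thesis using h nn by simp
    next
      assume h: "\<beta> = 8 \<and> 2 \<le> a"
      then have "real n > 1" using 3 by linarith
      then have n2: "real n \<ge> 2" by simp
      \<comment> \<open>For \<open>n \<ge> 2\<close> the right side of \<open>main\<close> is at
        least \<open>real n * (2 * (1 + e)\<^sup>2)\<close>, and
        \<open>4 * e \<le> (1 + e)\<^sup>2\<close>.\<close>
      have "8 * (real n * e) \<le> real n * (2 * (1 + e) + 2 * e * (1 + e))"
      proof -
        have "0 \<le> real n * (2 * (1 - e)\<^sup>2)" by simp
        then show ?thesis by (simp add: power2_eq_square algebra_simps)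
      qed
      also have "\<dots> \<le> real n * (real n * (1 + e) + 2 * e * (1 + e))"
        using n2 e by (intro mult_left_mono add_right_mono mult_right_mono) auto
      also have "\<dots> \<le> (1 + e) * (a * a)"
        using e by (simp add: algebra_simps)
      also have "\<dots> \<le> (1 + 2 * e - e\<^sup>2) * (a * a)"
        using e2 by (intro mult_right_mono) auto
      finally show ?thesis using h by simp
    qed
    have "parabola A (Suc n) + parabola A (n - 1) - 2 * parabola A n = - (1 + 2 * e - e\<^sup>2) / (a * a)"
    proof -
      have "max 0 (1 - real (Suc n) / a) = 0" using 3 a by (simp add: field_simps)
      moreover have "max 0 (1 - real n / a) = e / a" using 3 a e by (simp add: field_simps max_def)
      moreover have "max 0 (1 - real (n - 1) / a) = (e + 1) / a"
        using 3 a e n1 by (simp add: field_simps max_def)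
      ultimately show ?thesis unfolding parabola_def sq
        using a by (simp add: power_divide) (simp add: field_simps power2_eq_square)
    qed
    moreover have "parabola_deriv \<beta> A n = - (\<beta> * (real n * e) / (a * a)) / (a * a)"
    proof -
      have "max 0 (1 - real n / a) = e / a" using 3 a e by (simp add: field_simps max_def)
      then show ?thesis using a by (simp add: parabola_deriv_def sq mult_ac)
    qed
    moreover have "\<beta> * (real n * e) / (a * a) \<le> 1 + 2 * e - e\<^sup>2"
      using main a by (simp add: pos_divide_le_eq)
    then have "- (1 + 2 * e - e\<^sup>2) / (a * a) \<le> - (\<beta> * (real n * e) / (a * a)) / (a * a)"
      by (intro divide_right_mono) auto
    ultimately show ?thesis by linarith
  qed
qed

section \<open>Graph distance and curvature\<close>

lemma finite_neighbours: "graph q \<Longrightarrow> finite {y. q x y > 0}"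
  by (simp add: graph_def)

lemma laplacian_mono_at:
  assumes "graph q" and "\<And>y. q x y > 0 \<Longrightarrow> f y \<le> g y" and "f x = g x"
  shows "laplacian q f x \<le> laplacian q g x"
  unfolding laplacian_def using assms by (intro sum_mono mult_left_mono) auto

lemma laplacian_max_le_0:
  assumes "graph q" and "\<And>y. q x y > 0 \<Longrightarrow> f y \<le> f x"
  shows "laplacian q f x \<le> 0"
  unfolding laplacian_def using assms by (intro sum_nonpos mult_nonneg_nonpos) auto

lemma laplacian_add: "laplacian q (\<lambda>z. f z + g z) x = laplacian q f x + laplacian q g x"
  unfolding laplacian_def by (simp add: algebra_simps sum.distrib sum_subtractf)

lemma laplacian_diff: "laplacian q (\<lambda>z. f z - g z) x = laplacian q f x - laplacian q g x"
  unfolding laplacian_def by (simp add: algebra_simps sum.distrib sum_subtractf)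

lemma laplacian_cmult: "laplacian q (\<lambda>z. c * f z) x = c * laplacian q f x"
  unfolding laplacian_def sum_distrib_left by (intro sum.cong) (auto simp: algebra_simps)

lemma laplacian_add_const: "laplacian q (\<lambda>z. f z + c) x = laplacian q f x"
  unfolding laplacian_def by simp

lemma laplacian_fun_upd:
  assumes "graph q" "q x z > 0" "z \<noteq> x"
  shows "laplacian q (g(z := g z + c)) x = laplacian q g x + q x z * c"
proof -
  have "laplacian q (g(z := g z + c)) x - laplacian q g x
      = (\<Sum>y\<in>{y. q x y > 0}. if y = z then q x y * c else 0)"
    unfolding laplacian_def sum_subtractf[symmetric]
    by (intro sum.cong) (use assms in \<open>auto simp: algebra_simps\<close>)
  also have "\<dots> = q x z * c" using assms finite_neighbours[of q x] by (simp add: sum.delta')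
  finally show ?thesis by simp
qed

lemma q_min_le:
  assumes "graph q" "q x y > 0" shows "q_min q \<le> q x y"
  unfolding q_min_def by (rule cInf_lower) (use assms in \<open>auto intro!: bdd_belowI[of _ 0]\<close>)

section \<open>The graph metric and the use of curvature\<close>

locale nonneg_curved_graph =
  fixes q :: "'v \<Rightarrow> 'v \<Rightarrow> real"
  assumes graph: "graph q" and reversible: "reversible q" and connected: "connected_graph q"
    and curvature: "nonneg_ollivier q"
begin

abbreviation d where "d \<equiv> dist_graph q"

lemma dist_relpow: "(x, y) \<in> edges q ^^ d x y"
  unfolding dist_graph_def using connected unfolding connected_graph_def by (metis LeastI_ex)

lemma dist_le: "(x, y) \<in> edges q ^^ n \<Longrightarrow> d x y \<le> n"
  unfolding dist_graph_def by (rule Least_le)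

lemma dist_triangle: "d x z \<le> d x y + d y z"
  by (rule dist_le) (use dist_relpow[of x y] dist_relpow[of y z] in \<open>auto simp: relpow_add\<close>)

text \<open>Reversibility enters through this symmetry of the edge relation, which makes
  \<open>d\<close> symmetric.\<close>

lemma edge_sym: "q x y > 0 \<Longrightarrow> q y x > 0"
proof -
  assume q: "q x y > 0"
  obtain m :: "'v \<Rightarrow> real" where m: "\<And>x. m x > 0" "\<And>x y. q x y * m x = q y x * m y"
    using reversible unfolding reversible_def by blast
  have "q y x * m y > 0" using q m(1)[of x] by (simp flip: m(2))
  then show ?thesis using m(1)[of y] by (simp add: zero_less_mult_iff)
qed

lemma dist_sym: "d x y = d y x"
proof -
  have "(y, x) \<in> edges q ^^ n" if "(x, y) \<in> edges q ^^ n" for n x y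
    using that
  proof (induction n arbitrary: y)
    case (Suc n)
    then obtain z where "(x, z) \<in> edges q ^^ n" "(z, y) \<in> edges q" by auto
    then have "(y, z) \<in> edges q" "(z, x) \<in> edges q ^^ n"
      using Suc.IH edge_sym by (auto simp: edges_def)
    then show ?case by (rule relpow_Suc_I2)
  qed auto
  then show ?thesis by (meson antisym dist_le dist_relpow)
qed

lemma dist_self [simp]: "d x x = 0"
  using dist_le[of x x 0] by simp

lemma dist_eq_0 [simp]: "d x y = 0 \<longleftrightarrow> x = y"
  using dist_relpow[of x y] by auto

lemma dist_edge: "q x y > 0 \<Longrightarrow> d x y \<le> 1"
  by (rule dist_le) (auto simp: edges_def)

lemma geodesic_neighbour:
  assumes "d x y = Suc n" obtains z where "q x z > 0" "d z y = n" "z \<noteq> x"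
proof -
  have "(x, y) \<in> edges q ^^ Suc n" using dist_relpow[of x y] assms by simp
  then obtain z where z: "(x, z) \<in> edges q" "(z, y) \<in> edges q ^^ n" by (meson relpow_Suc_D2)
  have "d z y \<le> n" using z(2) by (rule dist_le)
  moreover have "d x z \<le> 1" using z(1) dist_edge[of x z] by (auto simp: edges_def)
  then have "Suc n \<le> 1 + d z y" using dist_triangle[of x y z] assms by linarith
  ultimately have "d z y = n" by simp
  moreover have "z \<noteq> x" using calculation assms by auto
  ultimately show ?thesis using that z(1) by (auto simp: edges_def)
qed

lemma finite_dist_ball: "finite {y. d x y \<le> n}"
proof -
  have fin: "finite {y. (x, y) \<in> edges q ^^ n}" for n
  proof (induction n)
    case (Suc n)
    have "{y. (x, y) \<in> edges q ^^ Suc n} \<subseteq> (\<Union>z\<in>{y. (x, y) \<in> edges q ^^ n}. {y. q z y > 0})"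
      by (auto simp: edges_def)
    then show ?case by (rule finite_subset) (use Suc graph in \<open>auto intro: finite_neighbours\<close>)
  qed simp
  have "{y. d x y \<le> n} \<subseteq> (\<Union>k\<in>{..n}. {y. (x, y) \<in> edges q ^^ k})"
    using dist_relpow by auto
  then show ?thesis by (rule finite_subset) (use fin in auto)
qed

text \<open>Such an \<open>F\<close> is a competitor in the infimum defining
  \<open>ollivier q x y\<close>: tightness at the pair gives both \<open>grad q y x F = 1\<close>
  and gradient norm exactly \<open>1\<close>. The curvature hypothesis is used through this
  form.\<close>

lemma laplacian_mono_geodesic:
  assumes lip: "\<And>z w. \<bar>F z - F w\<bar> \<le> real (d z w)" and tight: "F y - F x = real (d x y)"
  shows "laplacian q F y \<le> laplacian q F x"
proof (cases "x = y")
  case False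
  have grad_le: "\<bar>grad q z w F\<bar> \<le> 1" if "z \<noteq> w" for z w
    using lip[of z w] that by (simp add: grad_def divide_le_eq)
  have grad1: "grad q y x F = 1"
    using tight False by (simp add: grad_def dist_sym[of y x])
  have "grad_norm q F = 1"
  proof (rule antisym)
    show "grad_norm q F \<le> 1"
      unfolding grad_norm_def using grad_le by (auto intro!: SUP_least simp: one_ereal_def)
    have "ereal \<bar>grad q y x F\<bar> \<le> grad_norm q F"
      unfolding grad_norm_def by (rule SUP_upper2[of "(y, x)"]) (use False in auto)
    then show "1 \<le> grad_norm q F" by (simp add: grad1 one_ereal_def)
  qed
  then have "ollivier q x y \<le> ereal (grad q x y (laplacian q F))"
    unfolding ollivier_def by (intro INF_lower) (use grad1 in simp)
  moreover have "0 \<le> ollivier q x y" using curvature False by (auto simp: nonneg_ollivier_def)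
  ultimately have "0 \<le> ereal (grad q x y (laplacian q F))" by (rule order_trans[rotated])
  then show ?thesis
    using False by (simp add: grad_def zero_le_divide_iff)
qed simp

text \<open>The distance from \<open>o'\<close> is 1-Lipschitz and tight on the pair
  \<open>o'\<close>, \<open>x\<close>. The bound is uniform in \<open>x\<close>, which makes the
  distance a usable penalty on the whole graph.\<close>

lemma laplacian_dist_le:
  "laplacian q (\<lambda>z. real (d o' z)) x \<le> laplacian q (\<lambda>z. real (d o' z)) o'"
proof (rule laplacian_mono_geodesic)
  fix z w
  show "\<bar>real (d o' z) - real (d o' w)\<bar> \<le> real (d z w)"
    using dist_triangle[of o' z w] dist_triangle[of o' w z] dist_sym[of w z] by linarith
qed simp

text \<open>Kantorovich duality in disguise: the least \<open>b\<close>-Lipschitz majorant of \<open>g\<close> is a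
  competitor in the definition of the curvature, which replaces an optimal coupling.\<close>

lemma laplacian_le_of_linear_modulus:
  assumes b: "b \<ge> 0"
    and gh: "\<And>x' y'. x' \<in> insert x {z. q x z > 0} \<Longrightarrow> y' \<in> insert y {z. q y z > 0} \<Longrightarrow>
      g x' - h y' \<le> b * (real (d x' y') - real (d x y))"
    and eq: "g x = h y"
  shows "laplacian q g x \<le> laplacian q h y"
\<comment> \<open>The competitor below is \<open>F / b\<close>, so \<open>b = 0\<close> is separate:
  then \<open>x\<close> is a local maximum of \<open>g\<close> and \<open>y\<close> a local minimum
  of \<open>h\<close>.\<close>
proof (cases "b = 0")
  case True
  have "laplacian q g x \<le> 0"
    by (rule laplacian_max_le_0[OF graph]) (use gh[of _ y] eq True in auto)
  moreover have "laplacian q (\<lambda>z. - 1 * h z) y \<le> 0"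
    by (rule laplacian_max_le_0[OF graph]) (use gh[of x] eq True in auto)
  then have "0 \<le> laplacian q h y" by (simp only: laplacian_cmult)
  ultimately show ?thesis by simp
next
  case False
  with b have b: "b > 0" by simp
  define N where "N = insert x {z. q x z > 0}"
  have N: "finite N" "N \<noteq> {}" "x \<in> N" using graph by (auto simp: N_def finite_neighbours)
  define F where "F z = Max ((\<lambda>x'. g x' - b * real (d x' z)) ` N)" for z
  have F_ge: "g x' - b * real (d x' z) \<le> F z" if "x' \<in> N" for x' z
    unfolding F_def using N that by auto
  have F_le: "F z \<le> c" if "\<And>x'. x' \<in> N \<Longrightarrow> g x' - b * real (d x' z) \<le> c" for z c
    unfolding F_def using N that by auto
  have F_lip: "F z \<le> F w + b * real (d z w)" for z w
  proof (rule F_le)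
    fix x' assume "x' \<in> N"
    have "real (d x' w) \<le> real (d x' z) + real (d z w)" using dist_triangle[of x' w z] by linarith
    then have "b * real (d x' w) \<le> b * real (d x' z) + b * real (d z w)"
      using b by (simp flip: distrib_left)
    then show "g x' - b * real (d x' z) \<le> F w + b * real (d z w)"
      using F_ge[OF \<open>x' \<in> N\<close>, of w] by linarith
  qed
  have Fg: "g x' \<le> F x'" if "x' \<in> N" for x' using F_ge[OF that, of x'] by simp
  have Fh: "F y' + b * real (d x y) \<le> h y'" if "y' \<in> insert y {z. q y z > 0}" for y'
  proof -
    have "F y' \<le> h y' - b * real (d x y)"
      by (rule F_le) (use gh[OF _ that] in \<open>auto simp: N_def algebra_simps\<close>)
    then show ?thesis by simp
  qed
  \<comment> \<open>The cycle \<open>F y + b * d x y \<le> h y = g x \<le> F x \<le> F y + b * d x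
    y\<close> forces equality throughout. Hence \<open>F / b\<close> is tight on the pair, and
    \<open>F\<close> touches \<open>g\<close> at \<open>x\<close> and, shifted by a constant,
    \<open>h\<close> at \<open>y\<close>.\<close>
  have Fxy: "F x - F y = b * real (d x y)" "F x = g x" "F y + b * real (d x y) = h y"
    using F_lip[of x y] Fg[OF N(3)] Fh[of y] eq by auto
  have "laplacian q g x \<le> laplacian q F x"
    by (rule laplacian_mono_at[OF graph]) (use Fg Fxy in \<open>auto simp: N_def\<close>)
  also have "laplacian q (\<lambda>z. (1 / b) * F z) x \<le> laplacian q (\<lambda>z. (1 / b) * F z) y"
  proof (rule laplacian_mono_geodesic)
    fix z w
    have "\<bar>F z - F w\<bar> \<le> b * real (d z w)"
      using F_lip[of z w] F_lip[of w z] dist_sym[of z w] by auto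
    then have "\<bar>F z - F w\<bar> / b \<le> real (d z w)" using b by (simp add: divide_le_eq mult_ac)
    then show "\<bar>1 / b * F z - 1 / b * F w\<bar> \<le> real (d z w)"
      using b by (simp flip: diff_divide_distrib)
    show "1 / b * F x - 1 / b * F y = real (d y x)"
      using Fxy(1) b dist_sym[of x y] by (simp flip: diff_divide_distrib)
  qed
  then have "laplacian q F x \<le> laplacian q F y"
    using b unfolding laplacian_cmult by (simp add: divide_le_cancel)
  also have "laplacian q F y = laplacian q (\<lambda>z. F z + b * real (d x y)) y"
    by (simp add: laplacian_add_const)
  also have "\<dots> \<le> laplacian q h y"
    by (rule laplacian_mono_at[OF graph]) (use Fh Fxy in auto)
  finally show ?thesis .
qed

text \<open>The geodesic neighbours \<open>u\<close> of \<open>x\<close> and \<open>v\<close> of \<open>y\<close> may be coupled with "stay", so the values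
  \<open>g u\<close> and \<open>h v\<close> have room for a correction by the concavity defect of \<open>\<phi>\<close>; afterwards
  the linear modulus applies.\<close>

lemma laplacian_diff_le_at_max:
  fixes \<phi> :: "nat \<Rightarrow> real"
  assumes mono: "\<And>n. \<phi> n \<le> \<phi> (Suc n)"
    and conc: "\<And>n. \<phi> (Suc (Suc n)) - \<phi> (Suc n) \<le> \<phi> (Suc n) - \<phi> n"
    and max: "\<And>x' y'. g x' - h y' - \<phi> (d x' y') \<le> g x - h y - \<phi> (d x y)"
    and xy: "x \<noteq> y" and qm: "q_min q \<ge> 0"
  shows "laplacian q g x - laplacian q h y
     \<le> 2 * q_min q * (\<phi> (Suc (d x y)) + \<phi> (d x y - 1) - 2 * \<phi> (d x y))"
proof -
  obtain k where n: "d x y = Suc k" using xy by (cases "d x y") auto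
  \<comment> \<open>The slopes of \<open>\<phi>\<close> on the two sides of \<open>d x y\<close>;
    \<open>a - b\<close> is the negative of the second difference.\<close>
  define a b where "a = \<phi> (Suc k) - \<phi> k" and "b = \<phi> (Suc (Suc k)) - \<phi> (Suc k)"
  have ab: "b \<ge> 0" "b \<le> a" using mono conc by (auto simp: a_def b_def)
  have tr: "\<phi> m - \<phi> (Suc k) \<le> b * (real m - real (Suc k))" for m
    unfolding b_def by (rule concave_seq_tangent_right[of \<phi>, OF conc])
  have tl: "\<phi> m - \<phi> (Suc k) \<le> a * (real m - real (Suc k))" if "m \<le> k" for m
    unfolding a_def by (rule concave_seq_tangent_left[of \<phi>, OF conc that])
  \<comment> \<open>At distances below \<open>d x y\<close> the tangent of slope \<open>b\<close>
    has slack at least \<open>a - b\<close>, which pays for one correction.\<close>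
  have tl': "\<phi> m - \<phi> (Suc k) + (a - b) \<le> b * (real m - real (Suc k))" if "m \<le> k" for m
  proof -
    have "(a - b) * (real m - real (Suc k)) \<le> (a - b) * (- 1)"
      using that ab by (intro mult_left_mono) auto
    then show ?thesis using tl[OF that] by (simp add: algebra_simps)
  qed
  obtain u where u: "q x u > 0" "d u y = k" "u \<noteq> x" using geodesic_neighbour[OF n] .
  have "d y x = Suc k" using n dist_sym[of x y] by simp
  then obtain v where v: "q y v > 0" "d v x = k" "v \<noteq> y" by (rule geodesic_neighbour)
  define G where "G z = g z - g x" for z
  define H where "H z = h z - h y" for z
  have GH: "G x' - H y' \<le> \<phi> (d x' y') - \<phi> (Suc k)" for x' y'
    using max[of x' y'] by (simp add: G_def H_def n)
  have GH0: "G x = 0" "H y = 0" by (auto simp: G_def H_def)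
  have Gu: "G u \<le> - a" using GH[of u y] u GH0 by (simp add: a_def)
  have Hv: "- H v \<le> - a" using GH[of x v] v GH0 dist_sym[of x v] by (simp add: a_def)
  \<comment> \<open>Both corrections enlarge \<open>G - H\<close>, at \<open>u\<close> and at
    \<open>v\<close>; the case distinction checks that the linear modulus of slope \<open>b\<close>
    survives.\<close>
  define G' where "G' = G(u := G u + (a - b))"
  define H' where "H' = H(v := H v + - (a - b))"
  have "laplacian q G' x \<le> laplacian q H' y"
  proof (rule laplacian_le_of_linear_modulus[OF ab(1)])
    show "G' x = H' y" using u v GH0 by (simp add: G'_def H'_def)
    fix x' y' assume x': "x' \<in> insert x {z. q x z > 0}" and y': "y' \<in> insert y {z. q y z > 0}"
    have dx: "d x x' \<le> 1" using x' dist_edge[of x x'] by auto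
    have dy: "d y y' \<le> 1" using y' dist_edge[of y y'] by auto
    consider "x' \<noteq> u" "y' \<noteq> v" | "x' = u" "y' \<noteq> v" | "x' \<noteq> u" "y' = v" | "x' = u" "y' = v" by blast
    then have "G' x' - H' y' \<le> b * (real (d x' y') - real (Suc k))"
    proof cases
      case 1
      then show ?thesis using GH[of x' y'] tr[of "d x' y'"] by (simp add: G'_def H'_def)
    next
      case 2
      have *: "G' x' - H' y' = G u - H y' + (a - b)" using 2 by (simp add: G'_def H'_def)
      show ?thesis
      proof (cases "d u y' \<le> k")
        case True
        then show ?thesis using * GH[of u y'] tl'[OF True] 2 by simp
      next
        case False
        \<comment> \<open>At distance \<open>Suc k\<close> there is no slack. The two values are
          bounded separately instead: \<open>G u \<le> - a\<close> from the pair \<open>u\<close>,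
          \<open>y\<close> and \<open>- H y' \<le> b\<close> from the pair \<open>x\<close>,
          \<open>y'\<close>.\<close>
        have "d u y' \<le> k + 1" using dist_triangle[of u y' y] u dy by linarith
        then have du: "d u y' = Suc k" using False by simp
        have "d x y' \<le> Suc (Suc k)" using dist_triangle[of x y' y] n dy by linarith
        then have "b * (real (d x y') - real (Suc k)) \<le> b * 1"
          using ab by (intro mult_left_mono) auto
        then have "- H y' \<le> b" using GH[of x y'] GH0 tr[of "d x y'"] by simp
        then show ?thesis using * Gu du 2 by simp
      qed
    next
      case 3
      have *: "G' x' - H' y' = G x' - H v + (a - b)" using 3 by (simp add: G'_def H'_def)
      show ?thesis
      proof (cases "d x' v \<le> k")
        case True
        then show ?thesis using * GH[of x' v] tl'[OF True] 3 by simp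
      next
        case False
        have "d x' v \<le> k + 1"
          using dist_triangle[of x' v x] v dx dist_sym[of x v] dist_sym[of x x'] by linarith
        then have du: "d x' v = Suc k" using False by simp
        have "d x' y \<le> Suc (Suc k)" using dist_triangle[of x' y x] n dx dist_sym[of x x'] by linarith
        then have "b * (real (d x' y) - real (Suc k)) \<le> b * 1"
          using ab by (intro mult_left_mono) auto
        then have "G x' \<le> b" using GH[of x' y] GH0 tr[of "d x' y"] by simp
        then show ?thesis using * Hv du 3 by simp
      qed
    next
      case 4
      \<comment> \<open>Two corrections are due here, but \<open>G u - H v \<le> - 2 * a\<close>,
        and the distance drops by at most \<open>2\<close>.\<close>
      have "d x y \<le> d x u + d u v + d v y"
        using dist_triangle[of x y u] dist_triangle[of u y v] by linarith
      moreover have "d x u \<le> 1" "d v y \<le> 1" using dx dy 4 dist_sym[of v y] by auto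
      ultimately have "real (Suc k) - 2 \<le> real (d u v)" using n by linarith
      then have "b * (- 2) \<le> b * (real (d u v) - real (Suc k))"
        using ab by (intro mult_left_mono) auto
      moreover have "G' x' - H' y' = G u - H v + 2 * (a - b)" using 4 by (simp add: G'_def H'_def)
      ultimately show ?thesis using 4 Gu Hv by simp
    qed
    then show "G' x' - H' y' \<le> b * (real (d x' y') - real (d x y))" by (simp add: n)
  qed
  moreover have "laplacian q G' x = laplacian q G x + q x u * (a - b)"
    unfolding G'_def by (rule laplacian_fun_upd[OF graph u(1,3)])
  moreover have "laplacian q H' y = laplacian q H y + q y v * (- (a - b))"
    unfolding H'_def by (rule laplacian_fun_upd[OF graph v(1,3)])
  moreover have "laplacian q G x = laplacian q g x" "laplacian q H y = laplacian q h y"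
    unfolding G_def H_def by (simp_all add: laplacian_def)
  moreover have "q_min q * (a - b) \<le> q x u * (a - b)" "q_min q * (a - b) \<le> q y v * (a - b)"
    using q_min_le[OF graph] u v ab by (auto intro!: mult_right_mono)
  ultimately have "laplacian q g x - laplacian q h y \<le> 2 * q_min q * (b - a)"
    by (simp add: algebra_simps)
  moreover have "b - a = \<phi> (Suc (d x y)) + \<phi> (d x y - 1) - 2 * \<phi> (d x y)"
    by (simp add: n a_def b_def)
  ultimately show ?thesis by simp
qed

end

section \<open>The Dirichlet heat semigroup\<close>

lemma laplacian_restr_eq:
  "laplacian_restr q S g x = (if x \<in> S then laplacian q g x else 0)"
  by (simp add: laplacian_restr_def laplacian_def)

definition heat_coeff :: "('v \<Rightarrow> 'v \<Rightarrow> real) \<Rightarrow> 'v set \<Rightarrow> ('v \<Rightarrow> real) \<Rightarrow> nat \<Rightarrow> 'v \<Rightarrow> real" where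
  "heat_coeff q S f k = (laplacian_restr q S ^^ k) (\<lambda>z. f z * indicator S z)"

text \<open>The indicator at step 0 and the restricted Laplacian afterwards impose the Dirichlet
  condition off \<open>S\<close>.\<close>

lemma heat_coeff_outside: "x \<notin> S \<Longrightarrow> heat_coeff q S f k x = 0"
  by (cases k) (auto simp: heat_coeff_def laplacian_restr_eq)

lemma heat_restr_series: "heat_restr q S t f x = (\<Sum>k. (heat_coeff q S f k x / fact k) * t ^ k)"
  by (simp add: heat_restr_def heat_coeff_def mult_ac)

lemma heat_restr_outside: "x \<notin> S \<Longrightarrow> heat_restr q S t f x = 0"
  by (simp add: heat_restr_series heat_coeff_outside)

lemma heat_restr_0: "heat_restr q S 0 f x = f x * indicator S x"
  unfolding heat_restr_series powser_zero by (simp add: heat_coeff_def)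

text \<open>On a finite \<open>S\<close> the restricted Laplacian is bounded in sup norm, so its
  iterates grow at most geometrically and the exponential series converges for every time.\<close>

lemma heat_coeff_bound:
  assumes q: "graph q" and S: "finite S"
  shows "\<exists>M K. \<forall>k x. \<bar>heat_coeff q S f k x\<bar> \<le> M * K ^ k"
proof -
  define M where "M = (\<Sum>x\<in>S. \<bar>f x\<bar>)"
  define K where "K = (\<Sum>x\<in>S. \<Sum>y\<in>{y. q x y > 0}. q x y * 2)"
  have K0: "K \<ge> 0" unfolding K_def by (intro sum_nonneg) auto
  have step: "\<bar>laplacian_restr q S g x\<bar> \<le> C * K" if g: "\<And>z. \<bar>g z\<bar> \<le> C" for g C x
  proof (cases "x \<in> S")
    case True
    have C: "C \<ge> 0" using g[of x] by linarith
    have "\<bar>laplacian q g x\<bar> \<le> (\<Sum>y\<in>{y. q x y > 0}. \<bar>q x y * (g y - g x)\<bar>)"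
      unfolding laplacian_def by (rule sum_abs)
    also have "\<dots> \<le> (\<Sum>y\<in>{y. q x y > 0}. C * (q x y * 2))"
    proof (intro sum_mono)
      fix y assume "y \<in> {y. q x y > 0}"
      moreover have "\<bar>g y - g x\<bar> \<le> 2 * C" using g[of x] g[of y] by linarith
      ultimately have "q x y * \<bar>g y - g x\<bar> \<le> q x y * (2 * C)" by (intro mult_left_mono) auto
      then show "\<bar>q x y * (g y - g x)\<bar> \<le> C * (q x y * 2)"
        using \<open>y \<in> _\<close> by (simp add: abs_mult mult_ac)
    qed
    also have "\<dots> = C * (\<Sum>y\<in>{y. q x y > 0}. q x y * 2)" by (simp add: sum_distrib_left)
    also have "\<dots> \<le> C * K"
      unfolding K_def using True S C
      by (intro mult_left_mono member_le_sum sum_nonneg) auto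
    finally show ?thesis using True by (simp add: laplacian_restr_eq)
  next
    case False
    have "C \<ge> 0" using g[of x] by linarith
    then show ?thesis using False K0 by (simp add: laplacian_restr_eq)
  qed
  have "\<bar>heat_coeff q S f k x\<bar> \<le> M * K ^ k" for k x
  proof (induction k arbitrary: x)
    case 0
    have "\<bar>f x\<bar> \<le> M" if "x \<in> S"
      unfolding M_def using S that by (intro member_le_sum) auto
    moreover have "M \<ge> 0" by (simp add: M_def sum_nonneg)
    ultimately show ?case by (auto simp: heat_coeff_def indicator_def)
  next
    case (Suc k)
    have "heat_coeff q S f (Suc k) x = laplacian_restr q S (heat_coeff q S f k) x"
      by (simp add: heat_coeff_def)
    then show ?case using step[OF Suc.IH] by (simp add: mult_ac)
  qed
  then show ?thesis by blast
qed

lemma summable_heat_coeff: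
  assumes "graph q" "finite S"
  shows "summable (\<lambda>k. (heat_coeff q S f k x / fact k) * t ^ k)"
proof -
  obtain M K where MK: "\<And>k x. \<bar>heat_coeff q S f k x\<bar> \<le> M * K ^ k"
    using heat_coeff_bound[OF assms] by blast
  have "summable (\<lambda>k. M * (inverse (fact k) * (K * \<bar>t\<bar>) ^ k))"
    by (intro summable_mult summable_exp)
  then show ?thesis
  proof (rule summable_comparison_test')
    fix k :: nat
    have "\<bar>heat_coeff q S f k x\<bar> * (\<bar>t\<bar> ^ k / fact k) \<le> M * K ^ k * (\<bar>t\<bar> ^ k / fact k)"
      by (intro mult_right_mono MK) auto
    then show "norm (heat_coeff q S f k x / fact k * t ^ k) \<le> M * (inverse (fact k) * (K * \<bar>t\<bar>) ^ k)"
      by (simp add: abs_mult power_abs power_mult_distrib divide_inverse mult_ac)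
  qed
qed

text \<open>Termwise differentiation shifts the index by one, and the Laplacian, a finite sum,
  passes through the series. For \<open>x\<close> in \<open>S\<close> the full Laplacian appears, so
  the curvature estimates apply there.\<close>

lemma heat_restr_has_derivative:
  assumes q: "graph q" and S: "finite S" and x: "x \<in> S"
  shows "((\<lambda>t. heat_restr q S t f x) has_real_derivative laplacian q (heat_restr q S t f) x) (at t)"
proof -
  let ?c = "\<lambda>x k. heat_coeff q S f k x / fact k"
  have "((\<lambda>t. \<Sum>k. ?c x k * t ^ k) has_real_derivative (\<Sum>k. diffs (?c x) k * t ^ k)) (at t)"
    by (rule termdiffs_strong_converges_everywhere) (rule summable_heat_coeff[OF q S])
  moreover have "(\<Sum>k. diffs (?c x) k * t ^ k) = laplacian q (heat_restr q S t f) x"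
  proof -
    have sm: "summable (\<lambda>k. ?c y k * t ^ k)" for y by (rule summable_heat_coeff[OF q S])
    have "diffs (?c x) k * t ^ k = laplacian q (\<lambda>y. ?c y k * t ^ k) x" for k
    proof -
      have "diffs (?c x) k = heat_coeff q S f (Suc k) x / fact k"
        by (simp add: diffs_def del: of_nat_Suc)
      also have "heat_coeff q S f (Suc k) x = laplacian q (heat_coeff q S f k) x"
        using x by (simp add: heat_coeff_def laplacian_restr_eq)
      finally show ?thesis
        using laplacian_cmult[of q "t ^ k / fact k" "heat_coeff q S f k" x] by (simp add: mult_ac)
    qed
    then have "(\<Sum>k. diffs (?c x) k * t ^ k)
        = (\<Sum>k. \<Sum>y\<in>{y. q x y > 0}. q x y * (?c y k * t ^ k - ?c x k * t ^ k))"
      by (simp add: laplacian_def)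
    also have "\<dots> = (\<Sum>y\<in>{y. q x y > 0}. \<Sum>k. q x y * (?c y k * t ^ k - ?c x k * t ^ k))"
      by (rule suminf_sum) (intro summable_mult summable_diff sm)
    also have "\<dots> = laplacian q (heat_restr q S t f) x"
      unfolding laplacian_def heat_restr_series
    proof (rule sum.cong[OF refl])
      fix y
      show "(\<Sum>k. q x y * (?c y k * t ^ k - ?c x k * t ^ k))
          = q x y * ((\<Sum>k. ?c y k * t ^ k) - (\<Sum>k. ?c x k * t ^ k))"
        using suminf_mult[OF summable_diff[OF sm[of y] sm[of x]], of "q x y"]
          suminf_diff[OF sm[of y] sm[of x]] by simp
    qed
    finally show ?thesis .
  qed
  ultimately show ?thesis by (simp only: heat_restr_series)
qed

lemma heat_restr_le:
  assumes q: "graph q" and S: "finite S" and t: "t \<ge> 0" and f: "\<And>z. f z \<le> M" and M: "M \<ge> 0"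
  shows "heat_restr q S t f x \<le> M"
proof (cases "x \<in> S")
  case True
  have "heat_restr q S t f x \<le> M + \<eta>" if \<eta>: "\<eta> > 0" for \<eta>
  proof -
    \<comment> \<open>The loss \<open>e * s\<close> makes the maximum principle strict and costs at
      most \<open>\<eta>\<close> up to time \<open>t\<close>.\<close>
    define e where "e = \<eta> / (1 + t)"
    have e: "e > 0" "e * t \<le> \<eta>" using \<eta> t by (auto simp: e_def field_simps)
    have "heat_restr q S t f x - M - e * t \<le> 0"
    proof (rule parabolic_max_principle[where w = "\<lambda>s x. heat_restr q S s f x - M - e * s"
          and w' = "\<lambda>s x. laplacian q (heat_restr q S s f) x - e" and K = S and a = 0 and b = t])
      fix s p assume "p \<in> S" "0 \<le> s" "s \<le> t"
      show "((\<lambda>s. heat_restr q S s f p - M - e * s) has_real_derivative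
          laplacian q (heat_restr q S s f) p - e) (at s)"
        by (auto intro!: derivative_eq_intros heat_restr_has_derivative q S \<open>p \<in> S\<close>)
    next
      fix p assume "p \<in> S"
      then show "heat_restr q S 0 f p - M - e * 0 \<le> 0" using f by (simp add: heat_restr_0)
    next
      fix s p assume p: "p \<in> S" "0 < s" "s \<le> t" "0 < heat_restr q S s f p - M - e * s"
        and max: "\<And>p'. p' \<in> S \<Longrightarrow> heat_restr q S s f p' - M - e * s \<le> heat_restr q S s f p - M - e * s"
      have "0 < e * s" using p e by simp
      then have pos: "0 < heat_restr q S s f p" using p M by linarith
      \<comment> \<open>A positive maximum over \<open>S\<close> also dominates the zero values
        outside \<open>S\<close>, where neighbours of \<open>p\<close> may lie.\<close>
      have "heat_restr q S s f y \<le> heat_restr q S s f p" for y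
        using max[of y] pos heat_restr_outside[of y S q s f] by (cases "y \<in> S") auto
      then have "laplacian q (heat_restr q S s f) p \<le> 0" by (intro laplacian_max_le_0[OF q])
      then show "laplacian q (heat_restr q S s f) p - e < 0" using e by simp
    qed (use S t True in auto)
    then show ?thesis using e by simp
  qed
  then show ?thesis by (rule field_le_epsilon)
qed (use M in \<open>simp add: heat_restr_outside\<close>)

lemma heat_coeff_uminus: "heat_coeff q S (\<lambda>z. - f z) k x = - heat_coeff q S f k x"
proof (induction k arbitrary: x)
  case (Suc k)
  have "heat_coeff q S (\<lambda>z. - f z) k = (\<lambda>x. - 1 * heat_coeff q S f k x)" using Suc by auto
  moreover have "heat_coeff q S g (Suc k) x = laplacian_restr q S (heat_coeff q S g k) x" for g
    by (simp add: heat_coeff_def)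
  ultimately show ?case by (simp only: laplacian_restr_eq laplacian_cmult) simp
qed (simp add: heat_coeff_def)

lemma heat_restr_abs_le:
  assumes q: "graph q" and S: "finite S" and t: "t \<ge> 0" and f: "\<And>z. \<bar>f z\<bar> \<le> M"
  shows "\<bar>heat_restr q S t f x\<bar> \<le> M"
proof -
  have "M \<ge> 0" using f[of x] by linarith
  moreover have "f z \<le> M" "- f z \<le> M" for z using f[of z] by auto
  ultimately have "heat_restr q S t f x \<le> M" "heat_restr q S t (\<lambda>z. - f z) x \<le> M"
    by (auto intro: heat_restr_le[OF q S t])
  moreover have "heat_restr q S t (\<lambda>z. - f z) x = - heat_restr q S t f x"
    using suminf_minus[OF summable_heat_coeff[OF q S, of f x t]]
    by (simp add: heat_restr_series heat_coeff_uminus)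
  ultimately show ?thesis by simp
qed

section \<open>Comparison on the whole graph\<close>

context nonneg_curved_graph
begin

lemma laplacian_dist_nonneg: "0 \<le> laplacian q (\<lambda>z. real (d o' z)) o'"
  unfolding laplacian_def by (intro sum_nonneg) auto

text \<open>Since \<open>\<Delta>\<close> of the distance from \<open>o'\<close> is bounded by its value at \<open>o'\<close>, a small multiple of that
  distance confines positive maxima to a finite ball.\<close>

lemma heat_restr_exhaustion_error:
  assumes S: "finite S" "{z. d o' z \<le> R} \<subseteq> S" and T: "finite T" "{z. d o' z \<le> R} \<subseteq> T"
    and f: "\<And>z. \<bar>f z\<bar> \<le> M" and t: "t \<ge> 0" and \<epsilon>: "\<epsilon> > 0" "2 * M \<le> \<epsilon> * real R"
    and c: "c = laplacian q (\<lambda>z. real (d o' z)) o' + 1"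
  shows "heat_restr q S t f x - heat_restr q T t f x \<le> \<epsilon> * (real (d o' x) + c * t)"
proof -
  define V where "V z = real (d o' z)" for z
  define B where "B = {z. d o' z \<le> R}"
  define w where "w s z = heat_restr q S s f z - heat_restr q T s f z - \<epsilon> * (V z + c * s)" for s z
  define w' where "w' s z = laplacian q (heat_restr q S s f) z - laplacian q (heat_restr q T s f) z - \<epsilon> * c"
    for s z
  have c0: "c > 0" using c laplacian_dist_nonneg[of o'] by simp
  \<comment> \<open>Off the ball the penalty alone beats the trivial bound
    \<open>2 * M\<close>.\<close>
  have outside: "w s z \<le> 0" if "z \<notin> B" "s \<ge> 0" for s z
  proof -
    have "heat_restr q S s f z - heat_restr q T s f z \<le> 2 * M"
      using heat_restr_abs_le[where f = f, OF graph S(1) that(2) f, of z]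
        heat_restr_abs_le[where f = f, OF graph T(1) that(2) f, of z] by linarith
    also have "\<dots> \<le> \<epsilon> * (V z + c * s)"
    proof (rule order_trans[OF \<epsilon>(2)])
      have "real R \<le> V z + c * s" using that c0 by (auto simp: B_def V_def intro: add_increasing2)
      then show "\<epsilon> * real R \<le> \<epsilon> * (V z + c * s)" using \<epsilon> by simp
    qed
    finally show ?thesis by (simp add: w_def)
  qed
  have "w t x \<le> 0"
  proof (cases "x \<in> B")
    case True
    show ?thesis
    proof (rule parabolic_max_principle[where K = B and a = 0 and b = t and w = w and w' = w' and p = x])
      show "finite B" unfolding B_def by (rule finite_dist_ball)
    next
      fix s p assume "p \<in> B"
      then have "p \<in> S" "p \<in> T" using S T by (auto simp: B_def)
      then show "((\<lambda>s. w s p) has_real_derivative w' s p) (at s)"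
        unfolding w_def w'_def
        by (auto intro!: derivative_eq_intros heat_restr_has_derivative graph S T)
    next
      fix p assume "p \<in> B"
      then have "p \<in> S" "p \<in> T" using S T by (auto simp: B_def)
      then show "w 0 p \<le> 0" using \<epsilon> by (simp add: w_def heat_restr_0 V_def)
    next
      fix s p assume p: "p \<in> B" "0 < s" "0 < w s p" and max: "\<And>p'. p' \<in> B \<Longrightarrow> w s p' \<le> w s p"
      have glob: "w s z \<le> w s p" for z
        using max[of z] outside[of z s] p by (cases "z \<in> B") auto
      have "laplacian q (\<lambda>z. (heat_restr q S s f z - heat_restr q T s f z) - \<epsilon> * V z) p \<le> 0"
        by (rule laplacian_max_le_0[OF graph])
          (use glob in \<open>simp add: w_def algebra_simps\<close>)
      then have "laplacian q (heat_restr q S s f) p - laplacian q (heat_restr q T s f) p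
          \<le> \<epsilon> * laplacian q V p"
        unfolding laplacian_diff laplacian_cmult by simp
      \<comment> \<open>The summand \<open>1\<close> in \<open>c\<close> leaves a margin of
        \<open>\<epsilon>\<close>, which gives the strict sign.\<close>
      also have "\<dots> \<le> \<epsilon> * (c - 1)"
        using \<epsilon> c laplacian_dist_le[of o' p] by (simp add: V_def[abs_def])
      finally show "w' s p < 0" using \<epsilon> by (simp add: w'_def algebra_simps)
    qed (use t True in auto)
  qed (use outside t in simp)
  then show ?thesis by (simp add: w_def V_def)
qed

text \<open>The maximum principle for pairs of points. It runs over an arbitrary time interval so
  that phases of different speed can be chained. The factor \<open>2 * q_min q\<close> in the speed
  matches the two jumps in the curvature estimate, and the \<open>2\<close> in \<open>c\<close> pays
  for penalising both points.\<close>

lemma heat_restr_comparison: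
  assumes S: "finite S" "{z. d o' z \<le> R} \<subseteq> S"
    and f: "\<And>z. \<bar>f z\<bar> \<le> M" and \<epsilon>: "\<epsilon> > 0" "2 * M \<le> \<epsilon> * real R"
    and c: "c = 2 * laplacian q (\<lambda>z. real (d o' z)) o' + 1"
    and qm: "q_min q > 0" and ab: "0 \<le> a" "a \<le> b"
    and A: "\<And>s. A s = \<alpha> + \<beta> * (2 * q_min q) * s"
    and speed: "\<And>s. a \<le> s \<Longrightarrow> s \<le> b \<Longrightarrow> 1 \<le> A s \<and> (\<beta> = 7 \<and> A s \<le> 4 \<or> \<beta> = 8 \<and> 4 \<le> A s)"
    and init: "\<And>x y. heat_restr q S a f x - heat_restr q S a f y
      \<le> 2 * M * parabola (A a) (d x y) + \<epsilon> * (real (d o' x) + real (d o' y) + c * a)"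
  shows "heat_restr q S b f x - heat_restr q S b f y
      \<le> 2 * M * parabola (A b) (d x y) + \<epsilon> * (real (d o' x) + real (d o' y) + c * b)"
proof -
  define V where "V z = real (d o' z)" for z
  define B where "B = {z. d o' z \<le> R}"
  define v where "v s = heat_restr q S s f" for s
  define w where "w s p = v s (fst p) - v s (snd p) - 2 * M * parabola (A s) (d (fst p) (snd p))
      - \<epsilon> * (V (fst p) + V (snd p) + c * s)" for s p
  define w' where "w' s p = laplacian q (v s) (fst p) - laplacian q (v s) (snd p)
      - 2 * M * parabola_deriv (\<beta> * (2 * q_min q)) (A s) (d (fst p) (snd p)) - \<epsilon> * c" for s p
  have c0: "c > 0" using c laplacian_dist_nonneg[of o'] by simp
  have M: "M \<ge> 0" using f[of o'] by linarith
  have outside: "w s p \<le> 0" if "p \<notin> B \<times> B" and s: "a \<le> s" "s \<le> b" for s p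
  proof -
    have s0: "s \<ge> 0" using s ab by simp
    have "v s (fst p) - v s (snd p) \<le> 2 * M"
      using heat_restr_abs_le[where f = f, OF graph S(1) s0 f, of "fst p"]
        heat_restr_abs_le[where f = f, OF graph S(1) s0 f, of "snd p"] unfolding v_def by linarith
    also have "\<dots> \<le> \<epsilon> * (V (fst p) + V (snd p) + c * s)"
    proof (rule order_trans[OF \<epsilon>(2)])
      have "real R \<le> V (fst p) + V (snd p)" using that(1) by (cases p) (auto simp: B_def V_def)
      moreover have "0 \<le> c * s" using c0 s0 by simp
      ultimately show "\<epsilon> * real R \<le> \<epsilon> * (V (fst p) + V (snd p) + c * s)" using \<epsilon> by simp
    qed
    moreover have "0 \<le> 2 * M * parabola (A s) (d (fst p) (snd p))"
      using M speed[OF s] by (intro mult_nonneg_nonneg parabola_nonneg) auto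
    ultimately show ?thesis unfolding w_def by linarith
  qed
  have "w b (x, y) \<le> 0"
  proof (cases "(x, y) \<in> B \<times> B")
    case True
    show ?thesis
    proof (rule parabolic_max_principle[where K = "B \<times> B" and a = a and b = b and w = w and w' = w'
          and p = "(x, y)"])
      show "finite (B \<times> B)" unfolding B_def by (intro finite_SigmaI finite_dist_ball)
    next
      fix s p assume p: "p \<in> B \<times> B" and s: "a \<le> s" "s \<le> b"
      then have p: "fst p \<in> S" "snd p \<in> S" using S by (auto simp: B_def)
      have "0 < \<alpha> + \<beta> * (2 * q_min q) * s" using speed[OF s] by (simp add: A)
      note * = parabola_has_derivative[OF this]
      show "((\<lambda>s. w s p) has_real_derivative w' s p) (at s)"
        unfolding w_def w'_def v_def A
        by (rule derivative_eq_intros heat_restr_has_derivative graph S p * refl)+ simp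
    next
      fix p assume "p \<in> B \<times> B"
      then show "w a p \<le> 0" using init[of "fst p" "snd p"] by (simp add: w_def v_def V_def)
    next
      fix s p assume pB: "p \<in> B \<times> B" and s: "a < s" "s \<le> b" and pos: "0 < w s p"
        and max: "\<And>p'. p' \<in> B \<times> B \<Longrightarrow> w s p' \<le> w s p"
      obtain x y where p: "p = (x, y)" by (cases p)
      have As: "1 \<le> A s" "\<beta> = 7 \<and> A s \<le> 4 \<or> \<beta> = 8 \<and> 4 \<le> A s" using speed[of s] s by auto
      have glob: "w s p' \<le> w s p" for p'
        using max[of p'] outside[of p' s] pos s by (cases "p' \<in> B \<times> B") auto
      \<comment> \<open>The profile vanishes at distance 0, so on the diagonal only the negative
        penalty remains.\<close>
      have "x \<noteq> y"
      proof
        assume "x = y"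
        moreover have "0 \<le> \<epsilon> * (V x + V x + c * s)" using \<epsilon> c0 s ab by (simp add: V_def)
        ultimately show False using pos by (simp add: w_def p)
      qed
      define n where "n = d x y"
      have n: "n > 0" using \<open>x \<noteq> y\<close> by (simp add: n_def neq0_conv[symmetric] del: neq0_conv)
      \<comment> \<open>Absorbing the penalty into the two functions turns the maximum of
        \<open>w s\<close> into the hypothesis of the curvature estimate.\<close>
      have "laplacian q (\<lambda>z. v s z - \<epsilon> * V z) x - laplacian q (\<lambda>z. v s z + \<epsilon> * V z) y
          \<le> 2 * q_min q * (2 * M * parabola (A s) (Suc (d x y)) + 2 * M * parabola (A s) (d x y - 1)
            - 2 * (2 * M * parabola (A s) (d x y)))"
      proof (rule laplacian_diff_le_at_max)
        fix n
        show "2 * M * parabola (A s) n \<le> 2 * M * parabola (A s) (Suc n)"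
          using M As by (intro mult_left_mono parabola_mono) auto
        show "2 * M * parabola (A s) (Suc (Suc n)) - 2 * M * parabola (A s) (Suc n)
            \<le> 2 * M * parabola (A s) (Suc n) - 2 * M * parabola (A s) n"
          using mult_left_mono[OF parabola_concave[of "A s" n], of "2 * M"] M
          by (simp add: right_diff_distrib)
      next
        fix x' y'
        show "v s x' - \<epsilon> * V x' - (v s y' + \<epsilon> * V y') - 2 * M * parabola (A s) (d x' y')
            \<le> v s x - \<epsilon> * V x - (v s y + \<epsilon> * V y) - 2 * M * parabola (A s) (d x y)"
          using glob[of "(x', y')"] by (simp add: w_def p algebra_simps)
      qed (use \<open>x \<noteq> y\<close> qm in auto)
      also have "\<dots> = 4 * q_min q * M *
          (parabola (A s) (Suc n) + parabola (A s) (n - 1) - 2 * parabola (A s) n)"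
        by (simp add: n_def algebra_simps)
      also have "\<dots> \<le> 4 * q_min q * M * parabola_deriv \<beta> (A s) n"
        using M qm As n by (intro mult_left_mono parabola_supersolution) auto
      also have "\<dots> = 2 * M * parabola_deriv (\<beta> * (2 * q_min q)) (A s) n"
        by (simp add: parabola_deriv_def)
      finally have "laplacian q (v s) x - laplacian q (v s) y
          \<le> 2 * M * parabola_deriv (\<beta> * (2 * q_min q)) (A s) n
            + \<epsilon> * (laplacian q V x + laplacian q V y)"
        unfolding laplacian_diff laplacian_add laplacian_cmult by (simp add: algebra_simps)
      moreover have "\<epsilon> * (laplacian q V x + laplacian q V y) \<le> \<epsilon> * (c - 1)"
        using \<epsilon> c laplacian_dist_le[of o' x] laplacian_dist_le[of o' y]
        by (intro mult_left_mono) (auto simp: V_def[abs_def])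
      ultimately show "w' s p < 0"
        using \<epsilon> by (simp add: w'_def p n_def algebra_simps)
    qed (use ab True in auto)
  qed (use outside ab in simp)
  then show ?thesis by (simp add: w_def v_def V_def)
qed

text \<open>Starting from \<open>A = 1\<close>, the profile runs with speed \<open>7\<close> until
  \<open>A = 4\<close> and with speed \<open>8\<close> from then on. The head start \<open>1\<close>
  outweighs the slower phase, so \<open>A \<ge> 16 * q_min q * t\<close> at every time.\<close>

lemma heat_restr_diff_le:
  assumes S: "finite S" "{z. d o' z \<le> R} \<subseteq> S"
    and f: "\<And>z. \<bar>f z\<bar> \<le> M" and \<epsilon>: "\<epsilon> > 0" "2 * M \<le> \<epsilon> * real R"
    and c: "c = 2 * laplacian q (\<lambda>z. real (d o' z)) o' + 1"
    and qm: "q_min q > 0" and t: "t > 0"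
  shows "heat_restr q S t f x - heat_restr q S t f y
      \<le> real (d x y) * (M / sqrt (t * q_min q)) + \<epsilon> * (real (d o' x) + real (d o' y) + c * t)"
proof -
  define m where "m = q_min q"
  have m: "m > 0" using qm by (simp add: m_def)
  have M: "M \<ge> 0" using f[of o'] by linarith
  have init: "heat_restr q S 0 f x - heat_restr q S 0 f y
      \<le> 2 * M * parabola (1 + 7 * (2 * q_min q) * 0) (d x y)
        + \<epsilon> * (real (d o' x) + real (d o' y) + c * 0)" for x y
  proof -
    have "0 \<le> \<epsilon> * (real (d o' x) + real (d o' y))" using \<epsilon> by simp
    moreover have "heat_restr q S 0 f x - heat_restr q S 0 f y \<le> 2 * M"
      using heat_restr_abs_le[where f = f, OF graph S(1) order_refl f, of x]
        heat_restr_abs_le[where f = f, OF graph S(1) order_refl f, of y] by linarith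
    ultimately show ?thesis
      using parabola_1[of "d x y"] by (cases "x = y") (simp_all flip: neq0_conv)
  qed
  \<comment> \<open>The time at which \<open>1 + 14 * m * s\<close> reaches
    \<open>4\<close>.\<close>
  define t\<^sub>1 where "t\<^sub>1 = 3 / (14 * m)"
  have t1: "t\<^sub>1 > 0" "m * t\<^sub>1 = 3 / 14" using m by (auto simp: t\<^sub>1_def)
  have first: "heat_restr q S s f x - heat_restr q S s f y
      \<le> 2 * M * parabola (1 + 7 * (2 * q_min q) * s) (d x y)
        + \<epsilon> * (real (d o' x) + real (d o' y) + c * s)" if s: "0 \<le> s" "s \<le> t\<^sub>1" for s x y
  proof (rule heat_restr_comparison[where f = f and A = "\<lambda>s. 1 + 7 * (2 * q_min q) * s", OF S f \<epsilon> c qm _ s(1) refl _ init])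
    fix r assume "0 \<le> r" "r \<le> s"
    then have "0 \<le> r * m" "m * r \<le> m * t\<^sub>1" using s m by auto
    then show "1 \<le> 1 + 7 * (2 * q_min q) * r \<and> ((7::real) = 7 \<and> 1 + 7 * (2 * q_min q) * r \<le> 4
        \<or> (7::real) = 8 \<and> 4 \<le> 1 + 7 * (2 * q_min q) * r)"
      using t1 by (simp add: m_def)
  qed simp
  have "\<exists>A. 16 * (t * m) \<le> A \<and> heat_restr q S t f x - heat_restr q S t f y
      \<le> 2 * M * parabola A (d x y) + \<epsilon> * (real (d o' x) + real (d o' y) + c * t)"
  proof (cases "t \<le> t\<^sub>1")
    case True
    have "m * t \<le> m * t\<^sub>1" using True m by simp
    then show ?thesis
      using first[of t x y] True t t1 by (intro exI[of _ "1 + 7 * (2 * q_min q) * t"]) (simp add: m_def mult_ac)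
  next
    case False
    \<comment> \<open>The intercept \<open>4 / 7\<close> makes the two phases agree at
      \<open>t\<^sub>1\<close>.\<close>
    have eq: "1 + 7 * (2 * q_min q) * t\<^sub>1 = 4 / 7 + 8 * (2 * q_min q) * t\<^sub>1"
      using t1(2) by (simp add: m_def algebra_simps)
    note start = first[OF less_imp_le[OF t1(1)] order_refl, unfolded eq]
    have "heat_restr q S t f x - heat_restr q S t f y
      \<le> 2 * M * parabola (4 / 7 + 8 * (2 * q_min q) * t) (d x y)
        + \<epsilon> * (real (d o' x) + real (d o' y) + c * t)"
    proof (rule heat_restr_comparison[where f = f and A = "\<lambda>s. 4 / 7 + 8 * (2 * q_min q) * s" and a = t\<^sub>1,
          OF S f \<epsilon> c qm _ _ refl])
      fix r assume "t\<^sub>1 \<le> r"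
      then have "m * t\<^sub>1 \<le> m * r" using m by auto
      then show "1 \<le> 4 / 7 + 8 * (2 * q_min q) * r \<and> ((8::real) = 7 \<and> 4 / 7 + 8 * (2 * q_min q) * r \<le> 4
        \<or> (8::real) = 8 \<and> 4 \<le> 4 / 7 + 8 * (2 * q_min q) * r)"
        using t1 by (simp add: m_def)
    qed (rule start | use False t1 in simp)+
    then show ?thesis by (intro exI[of _ "4 / 7 + 8 * (2 * q_min q) * t"]) (simp add: m_def mult_ac)
  qed
  then obtain A where A: "16 * (t * m) \<le> A" and le: "heat_restr q S t f x - heat_restr q S t f y
      \<le> 2 * M * parabola A (d x y) + \<epsilon> * (real (d o' x) + real (d o' y) + c * t)"
    by blast
  have tm: "t * m > 0" using t m by simp
  have A0: "A > 0" using A tm by linarith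
  \<comment> \<open>The linear bound on the profile now gives the slope
    \<open>2 * M * 2 / (4 * sqrt (t * m))\<close>, which is the claimed constant.\<close>
  have "sqrt (16 * (t * m)) \<le> sqrt A" using A by (rule real_sqrt_le_mono)
  then have sq: "4 * sqrt (t * m) \<le> sqrt A" by (simp add: real_sqrt_mult)
  have "parabola A (d x y) \<le> 2 * real (d x y) / sqrt A"
    using A0 by (rule parabola_le_linear)
  also have "\<dots> \<le> 2 * real (d x y) / (4 * sqrt (t * m))"
    using sq tm A0 by (intro divide_left_mono) (auto intro!: mult_pos_pos)
  finally have "2 * M * parabola A (d x y) \<le> 2 * M * (2 * real (d x y) / (4 * sqrt (t * m)))"
    using M by (intro mult_left_mono) auto
  also have "\<dots> = real (d x y) * (M / sqrt (t * q_min q))" by (simp add: m_def)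
  finally show ?thesis using le by linarith
qed

end

section \<open>The heat semigroup\<close>

lemma exhaustion_eventually_superset:
  assumes "exhaustion S" "finite B"
  shows "\<forall>\<^sub>F i in sequentially. B \<subseteq> S i"
proof -
  have "\<exists>i. x \<in> S i" for x using assms by (auto simp: exhaustion_def)
  then obtain j where j: "\<And>x. x \<in> S (j x)" by metis
  define N where "N = Max (insert 0 (j ` B))"
  have "B \<subseteq> S i" if "N \<le> i" for i
  proof
    fix x assume "x \<in> B"
    then have "j x \<le> N" unfolding N_def using assms by (intro Max_ge) auto
    then have "S (j x) \<subseteq> S i" using assms incseqD[of S "j x" i] that by (auto simp: exhaustion_def)
    then show "x \<in> S i" using j by blast
  qed
  then show ?thesis by (auto simp: eventually_sequentially)
qed

lemma exhaustion_exists: "\<exists>S :: nat \<Rightarrow> 'v::countable set. exhaustion S"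
proof
  have "finite (to_nat -` {..n} :: 'v set)" for n by (rule finite_vimageI) auto
  then show "exhaustion (\<lambda>n. to_nat -` {..n} :: 'v set)"
    by (auto simp: exhaustion_def incseq_def)
qed

text \<open>The description in \<open>heat\<close> is proper: Dirichlet values on any two finite
  sets containing a large ball are close, which gives both the Cauchy property and independence of
  the exhaustion.\<close>

lemma heat_tendsto:
  fixes q :: "'v::countable \<Rightarrow> 'v \<Rightarrow> real"
  assumes q: "nonneg_curved_graph q" and f: "\<And>z. \<bar>f z\<bar> \<le> M" and t: "t \<ge> 0"
    and S: "exhaustion S"
  shows "(\<lambda>i. heat_restr q (S i) t f x) \<longlonglongrightarrow> heat q t f x"
proof -
  interpret nonneg_curved_graph q by (rule q)
  have M: "M \<ge> 0" using f[of x] by linarith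
  have close: "\<exists>B. finite B \<and> (\<forall>S T. finite S \<longrightarrow> finite T \<longrightarrow> B \<subseteq> S \<longrightarrow> B \<subseteq> T \<longrightarrow>
      \<bar>heat_restr q S t f x - heat_restr q T t f x\<bar> \<le> \<delta>)" if \<delta>: "\<delta> > 0" for \<delta>
  proof -
    \<comment> \<open>The base point of the penalty is \<open>x\<close> itself, so the error at
      \<open>x\<close> is just \<open>\<epsilon> * (c * t)\<close>.\<close>
    define c where "c = laplacian q (\<lambda>z. real (d x z)) x + 1"
    have c0: "c * t \<ge> 0" using laplacian_dist_nonneg[of x] t by (simp add: c_def)
    define \<epsilon> where "\<epsilon> = \<delta> / (c * t + 1)"
    have \<epsilon>: "\<epsilon> > 0" using c0 \<delta> by (simp add: \<epsilon>_def)
    obtain R :: nat where "2 * M / \<epsilon> \<le> real R" using real_arch_simple by blast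
    then have R: "2 * M \<le> \<epsilon> * real R" using \<epsilon> by (simp add: divide_le_eq mult_ac)
    have "\<epsilon> * (real (d x x) + c * t) \<le> \<delta>"
      using \<delta> c0 by (simp add: \<epsilon>_def divide_le_eq mult_left_mono)
    then have "\<bar>heat_restr q S t f x - heat_restr q T t f x\<bar> \<le> \<delta>"
      if "finite S" "finite T" "{z. d x z \<le> R} \<subseteq> S" "{z. d x z \<le> R} \<subseteq> T" for S T
      using heat_restr_exhaustion_error[where f = f, OF that(1,3,2,4) f t \<epsilon> R c_def, of x]
        heat_restr_exhaustion_error[where f = f, OF that(2,4,1,3) f t \<epsilon> R c_def, of x] by linarith
    then show ?thesis using finite_dist_ball by blast
  qed
  have fin: "finite (S i)" if "exhaustion S" for S :: "nat \<Rightarrow> 'v set" and i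
    using that by (simp add: exhaustion_def)
  have diff: "(\<lambda>i. heat_restr q (T i) t f x - heat_restr q (S i) t f x) \<longlonglongrightarrow> 0"
    if T: "exhaustion T" for T
  proof (rule LIMSEQ_I)
    fix r :: real assume "r > 0"
    then obtain B where B: "finite B" "\<And>S T. finite S \<Longrightarrow> finite T \<Longrightarrow> B \<subseteq> S \<Longrightarrow> B \<subseteq> T \<Longrightarrow>
      \<bar>heat_restr q S t f x - heat_restr q T t f x\<bar> \<le> r / 2" using close[of "r / 2"] by auto
    have "\<forall>\<^sub>F i in sequentially. norm (heat_restr q (T i) t f x - heat_restr q (S i) t f x - 0) < r"
      using exhaustion_eventually_superset[OF S B(1)] exhaustion_eventually_superset[OF T B(1)]
    proof eventually_elim
      case (elim i)
      then show ?case using B(2)[OF fin[OF T] fin[OF S], of i i] \<open>r > 0\<close> by auto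
    qed
    then show "\<exists>no. \<forall>n\<ge>no. norm (heat_restr q (T n) t f x - heat_restr q (S n) t f x - 0) < r"
      by (simp add: eventually_sequentially)
  qed
  have "Cauchy (\<lambda>i. heat_restr q (S i) t f x)"
  proof (rule CauchyI)
    fix r :: real assume "r > 0"
    then obtain B where B: "finite B" "\<And>S T. finite S \<Longrightarrow> finite T \<Longrightarrow> B \<subseteq> S \<Longrightarrow> B \<subseteq> T \<Longrightarrow>
      \<bar>heat_restr q S t f x - heat_restr q T t f x\<bar> \<le> r / 2" using close[of "r / 2"] by auto
    obtain N where N: "\<And>i. i \<ge> N \<Longrightarrow> B \<subseteq> S i"
      using exhaustion_eventually_superset[OF S B(1)] by (auto simp: eventually_sequentially)
    have "norm (heat_restr q (S m) t f x - heat_restr q (S n) t f x) < r" if "m \<ge> N" "n \<ge> N" for m n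
      using B(2)[OF fin[OF S] fin[OF S], of m n] N that \<open>r > 0\<close> by auto
    then show "\<exists>N. \<forall>m\<ge>N. \<forall>n\<ge>N. norm (heat_restr q (S m) t f x - heat_restr q (S n) t f x) < r"
      by blast
  qed
  then obtain l where l: "(\<lambda>i. heat_restr q (S i) t f x) \<longlonglongrightarrow> l"
    using Cauchy_convergent convergent_def by blast
  have "heat q t f x = l"
    unfolding heat_def
  proof (rule the_equality)
    show "\<forall>T. exhaustion T \<longrightarrow> (\<lambda>i. heat_restr q (T i) t f x) \<longlonglongrightarrow> l"
      using tendsto_add[OF diff l] by auto
    show "v = l" if "\<forall>T. exhaustion T \<longrightarrow> (\<lambda>i. heat_restr q (T i) t f x) \<longlonglongrightarrow> v" for v
      using that S l LIMSEQ_unique by blast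
  qed
  then show ?thesis using l by simp
qed

lemma heat_diff_le:
  fixes q :: "'v::countable \<Rightarrow> 'v \<Rightarrow> real"
  assumes q: "nonneg_curved_graph q" and f: "\<And>z. \<bar>f z\<bar> \<le> M" and t: "t > 0" and qm: "q_min q > 0"
  shows "heat q t f x - heat q t f y \<le> real (dist_graph q x y) * (M / sqrt (t * q_min q))"
proof -
  interpret nonneg_curved_graph q by (rule q)
  define K where "K = real (d x y) * (M / sqrt (t * q_min q))"
  obtain S :: "nat \<Rightarrow> 'v set" where S: "exhaustion S" using exhaustion_exists by blast
  define c where "c = 2 * laplacian q (\<lambda>z. real (d x z)) x + 1"
  \<comment> \<open>\<open>L\<close> depends neither on \<open>\<epsilon>\<close> nor on the radius
    \<open>R\<close> or the index \<open>i\<close>, so the error \<open>\<epsilon> * L\<close> can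
    be made arbitrarily small.\<close>
  define L where "L = real (d x x) + real (d x y) + c * t"
  have L: "L \<ge> 0" using laplacian_dist_nonneg[of x] t by (simp add: L_def c_def)
  have "heat q t f x - heat q t f y \<le> K + \<delta>" if \<delta>: "\<delta> > 0" for \<delta>
  proof -
    define \<epsilon> where "\<epsilon> = \<delta> / (L + 1)"
    have \<epsilon>: "\<epsilon> > 0" using L \<delta> by (simp add: \<epsilon>_def)
    obtain R :: nat where "2 * M / \<epsilon> \<le> real R" using real_arch_simple by blast
    then have R: "2 * M \<le> \<epsilon> * real R" using \<epsilon> by (simp add: divide_le_eq mult_ac)
    have "\<epsilon> * L \<le> \<delta>" using \<delta> L by (simp add: \<epsilon>_def divide_le_eq mult_left_mono)
    have "\<forall>\<^sub>F i in sequentially. heat_restr q (S i) t f x - heat_restr q (S i) t f y \<le> K + \<delta>"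
      using exhaustion_eventually_superset[OF S finite_dist_ball[of x R]]
    proof eventually_elim
      case (elim i)
      have "finite (S i)" using S by (simp add: exhaustion_def)
      from heat_restr_diff_le[where f = f, OF this elim f \<epsilon> R c_def qm t, of x y] \<open>\<epsilon> * L \<le> \<delta>\<close>
      show ?case unfolding K_def L_def by linarith
    qed
    moreover have "(\<lambda>i. heat_restr q (S i) t f x - heat_restr q (S i) t f y)
        \<longlonglongrightarrow> heat q t f x - heat q t f y"
      using t by (intro tendsto_diff heat_tendsto[where f = f, OF q f _ S]) auto
    ultimately show ?thesis by (intro tendsto_upperbound) auto
  qed
  then show ?thesis unfolding K_def by (rule field_le_epsilon)
qed

text \<open>For \<open>q_min q = 0\<close> the right side is informally infinite, while division by
  zero in HOL would make it \<open>0\<close>; the assumption \<open>q_min q > 0\<close> excludes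
  this reading.\<close>

theorem mainTheorem9:
  fixes q :: "'v::countable \<Rightarrow> 'v \<Rightarrow> real" and f :: "'v \<Rightarrow> real" and t :: real
  assumes "graph q" and "reversible q" and "connected_graph q"
    and "nonneg_ollivier q"
    and "bounded_fun f" and "t > 0"
    and "q_min q > 0"
  shows "grad_norm q (heat q t f) \<le> ereal (sup_norm f / sqrt (t * q_min q))"
proof -
  interpret nonneg_curved_graph q by unfold_locales (use assms in auto)
  define K where "K = sup_norm f / sqrt (t * q_min q)"
  have f: "\<bar>f z\<bar> \<le> sup_norm f" for z
    unfolding sup_norm_def using assms(5)
    by (intro cSUP_upper) (auto simp: bounded_fun_def intro: bdd_aboveI)
  have le: "heat q t f x - heat q t f y \<le> real (d x y) * K" for x y
    unfolding K_def by (rule heat_diff_le[where f = f, OF nonneg_curved_graph_axioms f assms(6,7)])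
  have "\<bar>grad q x y (heat q t f)\<bar> \<le> K" if "x \<noteq> y" for x y
  proof -
    have "\<bar>heat q t f x - heat q t f y\<bar> \<le> real (d x y) * K"
      using le[of x y] le[of y x] dist_sym[of x y] by auto
    then show ?thesis using that by (simp add: grad_def divide_le_eq mult_ac)
  qed
  then show ?thesis unfolding grad_norm_def K_def by (auto intro!: SUP_least)
qed

end
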